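(* Let $I=\{(z_k,\rho(z_k))\}_{k=1}^N$ be a discrete gray scale image and let $n\ge 0$ be an integer. For every $\theta\in\mathbb{R}$, the $n$-th order moment $m_n(\theta)$ of the Radon transform $f_\theta$ of $I$ satisfies $$m_n(\theta)=\frac{1}{2^n}\sum_{l=0}^n\binom{n}{l}\,\mu_{l,n-l}\,e^{i(n-2l)\theta}.$$ That is, $m_n(\theta)$ is this linear combination of the entries $\binom{n}{l}\mu_{l,n-l}$, $0\le l\le n$, of the $(n+1)$-th row of the Pascal triangle $T^r(I)$ for any $r\ge n$.
   Context: A discrete gray scale image $I=\{(z_k,\rho(z_k))\}_{k=1}^N$ consists of finitely many pairwise distinct pixel locations $z_k=x_k+iy_k\in\mathbb{C}$ and intensities $\rho(z_k)\in\mathbb{R}_{\ge 0}$. Its complex moments are $\mu_{j,l}=\sum_{k=1}^N z_k^j\bar z_k^l\rho(z_k)$ for integers $j,l\ge 0$ (with $0^0=1$). The Pascal triangle $T^r(I)$ of order $r$ has rows $n+1=1,\dots,r+1$, where row $n+1$ has entries $\binom{n}{l}\mu_{l,n-l}$, $l=0,\dots,n$. The Radon transform is $f_\theta(r)=\sum_{k:\,x_k\cos\theta+y_k\sin\theta=r}\rho(z_k)$ for $r\in\mathbb{R}$, and its $n$-th order moment is $m_n(\theta)=\sum_r r^n f_\theta(r)$, the sum being over the finitely many values $r=x_k\cos\theta+y_k\sin\theta$, $k=1,\dots,N$. *)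

theory Defs
  imports Complex_Main
begin

text \<open>
  The image \<open>{(z\<^sub>k, \<rho>(z\<^sub>k)) | k = 1, \<dots>, N}\<close> is given by the data \<open>N\<close>, \<open>z\<close> and \<open>\<rho>\<close>;
  only the values of \<open>z\<close> on \<open>{1..N}\<close> and of \<open>\<rho>\<close> at these pixels matter.
\<close>

definition gray_scale_image :: "nat \<Rightarrow> (nat \<Rightarrow> complex) \<Rightarrow> (complex \<Rightarrow> real) \<Rightarrow> bool" where
  "gray_scale_image N z \<rho> \<longleftrightarrow> inj_on z {1..N} \<and> (\<forall>k\<in>{1..N}. \<rho> (z k) \<ge> 0)"

definition complex_moment ::
  "nat \<Rightarrow> (nat \<Rightarrow> complex) \<Rightarrow> (complex \<Rightarrow> real) \<Rightarrow> nat \<Rightarrow> nat \<Rightarrow> complex" where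
  "complex_moment N z \<rho> j l =
     (\<Sum>k=1..N. z k ^ j * cnj (z k) ^ l * complex_of_real (\<rho> (z k)))"

text \<open>
  The triangle of order \<open>r\<close> is the list of its \<open>r + 1\<close> rows. Lists are indexed from 0,
  so row number \<open>n + 1\<close> is \<open>pascal_triangle N z \<rho> r ! n\<close>; it has \<open>n + 1\<close> entries.
\<close>

definition pascal_triangle ::
  "nat \<Rightarrow> (nat \<Rightarrow> complex) \<Rightarrow> (complex \<Rightarrow> real) \<Rightarrow> nat \<Rightarrow> complex list list" where
  "pascal_triangle N z \<rho> r =
     map (\<lambda>n. map (\<lambda>l. of_nat (n choose l) * complex_moment N z \<rho> l (n - l)) [0..<n + 1])
       [0..<r + 1]"

definition projection :: "real \<Rightarrow> complex \<Rightarrow> real" where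
  "projection \<theta> w = Re w * cos \<theta> + Im w * sin \<theta>"

definition radon ::
  "nat \<Rightarrow> (nat \<Rightarrow> complex) \<Rightarrow> (complex \<Rightarrow> real) \<Rightarrow> real \<Rightarrow> real \<Rightarrow> real" where
  "radon N z \<rho> \<theta> r = (\<Sum>k | k \<in> {1..N} \<and> projection \<theta> (z k) = r. \<rho> (z k))"

text \<open>
  The sum ranges over the set of projected values, so a value attained by
  several pixels contributes only once.
\<close>

definition radon_moment ::
  "nat \<Rightarrow> (nat \<Rightarrow> complex) \<Rightarrow> (complex \<Rightarrow> real) \<Rightarrow> nat \<Rightarrow> real \<Rightarrow> real" where
  "radon_moment N z \<rho> n \<theta> =
     (\<Sum>r \<in> (\<lambda>k. projection \<theta> (z k)) ` {1..N}. r ^ n * radon N z \<rho> \<theta> r)"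

end

theory Submission
  imports Defs
begin

text \<open>
  Grouping pixels by their projected value turns the moment into the sum of
  \<open>(x\<^sub>k cos \<theta> + y\<^sub>k sin \<theta>)\<^sup>n \<rho>(z\<^sub>k)\<close> over the pixels. The base of the power is
  \<open>(z\<^sub>k e\<^sup>-\<^sup>i\<^sup>\<theta> + cnj z\<^sub>k e\<^sup>i\<^sup>\<theta>) / 2\<close>, and the binomial theorem applies.
\<close>

text \<open>The pixels split into fibres of the projection; on the fibre over \<open>r\<close> the
  projection is constantly \<open>r\<close>, so \<open>r ^ n\<close> can be moved inside the sum of
  intensities.\<close>

lemma radon_moment_eq_sum_pixels:
  "radon_moment N z \<rho> n \<theta> = (\<Sum>k=1..N. projection \<theta> (z k) ^ n * \<rho> (z k))"
  unfolding radon_moment_def radon_def sum_distrib_left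
  by (subst sum.image_gen[where S = "{1..N}" and g = "\<lambda>k. projection \<theta> (z k)"])
    (auto intro!: sum.cong)

text \<open>The two summands are conjugate, so half their sum is the real part of \<open>w\<close>
  rotated by \<open>- \<theta>\<close>.\<close>

lemma projection_eq:
  "complex_of_real (projection \<theta> w) = (w * cis (- \<theta>) + cnj w * cis \<theta>) / 2"
  by (simp add: projection_def complex_eq_iff)

lemma projection_power:
  "complex_of_real (projection \<theta> w ^ n) =
     1 / 2 ^ n * (\<Sum>l=0..n. of_nat (n choose l) * (w ^ l * cnj w ^ (n - l)) *
       exp (\<i> * of_int (int n - 2 * int l) * complex_of_real \<theta>))"
proof -
  \<comment> \<open>The angles \<open>- l * \<theta>\<close> and \<open>(n - l) * \<theta>\<close>
    add up; \<open>l \<le> n\<close> makes the truncated \<open>n - l\<close> a true difference,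
    while \<open>n - 2 * l\<close> may be negative and so lives in \<open>int\<close>.\<close>
  have phase: "cis (- \<theta>) ^ l * cis \<theta> ^ (n - l) =
      exp (\<i> * of_int (int n - 2 * int l) * complex_of_real \<theta>)" if "l \<le> n" for l
  proof -
    have "cis (- \<theta>) ^ l * cis \<theta> ^ (n - l) = cis ((real n - 2 * real l) * \<theta>)"
      using that by (simp add: DeMoivre cis_mult of_nat_diff algebra_simps)
    then show ?thesis
      by (simp add: cis_conv_exp mult.assoc)
  qed
  have "complex_of_real (projection \<theta> w ^ n) = 1 / 2 ^ n * (w * cis (- \<theta>) + cnj w * cis \<theta>) ^ n"
    by (simp add: projection_eq power_divide)
  also have "(w * cis (- \<theta>) + cnj w * cis \<theta>) ^ n =
      (\<Sum>l=0..n. of_nat (n choose l) * (w ^ l * cnj w ^ (n - l)) * (cis (- \<theta>) ^ l * cis \<theta> ^ (n - l)))"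
    unfolding binomial_ring atMost_atLeast0
    by (simp add: power_mult_distrib mult_ac del: cis_inverse)
  also have "\<dots> = (\<Sum>l=0..n. of_nat (n choose l) * (w ^ l * cnj w ^ (n - l)) *
      exp (\<i> * of_int (int n - 2 * int l) * complex_of_real \<theta>))"
    by (intro sum.cong refl) (simp only: phase atLeastAtMost_iff)
  finally show ?thesis .
qed

lemma pascal_triangle_nth:
  assumes "n \<le> r" "l \<le> n"
  shows "pascal_triangle N z \<rho> r ! n ! l = of_nat (n choose l) * complex_moment N z \<rho> l (n - l)"
  using assms by (simp add: pascal_triangle_def del: upt_Suc)

theorem lemma3:
  fixes N n :: nat and z :: "nat \<Rightarrow> complex" and \<rho> :: "complex \<Rightarrow> real" and \<theta> :: real
  assumes "gray_scale_image N z \<rho>"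
  shows "complex_of_real (radon_moment N z \<rho> n \<theta>) =
           1 / 2 ^ n * (\<Sum>l=0..n. of_nat (n choose l) * complex_moment N z \<rho> l (n - l) *
             exp (\<i> * of_int (int n - 2 * int l) * complex_of_real \<theta>))
         \<and> (\<forall>r\<ge>n. complex_of_real (radon_moment N z \<rho> n \<theta>) =
           1 / 2 ^ n * (\<Sum>l=0..n. pascal_triangle N z \<rho> r ! n ! l *
             exp (\<i> * of_int (int n - 2 * int l) * complex_of_real \<theta>)))"
proof -
  let ?e = "\<lambda>l. exp (\<i> * of_int (int n - 2 * int l) * complex_of_real \<theta>)"
  have "complex_of_real (radon_moment N z \<rho> n \<theta>) =
      (\<Sum>k=1..N. complex_of_real (projection \<theta> (z k) ^ n) * complex_of_real (\<rho> (z k)))"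
    by (simp add: radon_moment_eq_sum_pixels)
  also have "\<dots> = 1 / 2 ^ n * (\<Sum>k=1..N. \<Sum>l=0..n.
      of_nat (n choose l) * (z k ^ l * cnj (z k) ^ (n - l) * complex_of_real (\<rho> (z k))) * ?e l)"
    unfolding projection_power sum_distrib_left sum_distrib_right
    by (intro sum.cong refl) (simp only: mult_ac)
  \<comment> \<open>Binomial coefficient and phase do not depend on the pixel, so exchanging the two
    sums collects the pixel terms into moments.\<close>
  also have "\<dots> = 1 / 2 ^ n * (\<Sum>l=0..n. of_nat (n choose l) * complex_moment N z \<rho> l (n - l) * ?e l)"
    unfolding complex_moment_def sum_distrib_left sum_distrib_right
    by (subst sum.swap) (rule refl)
  finally have moment: "complex_of_real (radon_moment N z \<rho> n \<theta>) =
      1 / 2 ^ n * (\<Sum>l=0..n. of_nat (n choose l) * complex_moment N z \<rho> l (n - l) * ?e l)" .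
  \<comment> \<open>For \<open>r \<ge> n\<close> the row with index \<open>n\<close> exists, and
    every summation index \<open>l \<le> n\<close> lies inside it.\<close>
  then show ?thesis
    by (simp add: pascal_triangle_nth)
qed

end
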